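(* Let $D$ be a division ring and $n\ge 1$. Then $M_n(D)$ is a $\sqrt{J}$-clean ring if and only if $D\cong\mathbb{F}_2$.
   Context: For a ring $R$ (associative with identity $1\neq 0$, not necessarily commutative), $J(R)$ is the Jacobson radical of $R$, and $\sqrt{J(R)}=\{z\in R : z^k\in J(R)\text{ for some } k\ge 1\}$. A ring $R$ is $\sqrt{J}$-clean if every $x\in R$ can be written as $x=e+z$ with $e$ an idempotent of $R$ and $z\in\sqrt{J(R)}$. $M_n(D)$ is the ring of all $n\times n$ matrices over $D$, and $\mathbb{F}_2$ is the field with two elements. *)

theory Defs
  imports
    "HOL-Algebra.Ideal"
    "HOL-Algebra.QuotRing"
    "HOL-Library.Z2"
    "Jordan_Normal_Form.Matrix"
    "Jordan_Normal_Form.VS_Connect"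
begin

text \<open>
  The locales \<open>ideal\<close> and \<open>maximalideal\<close> of the library are two-sided. The Jacobson radical of a
  noncommutative ring is the intersection of the maximal one-sided ideals; we use left ideals
  (right ideals give the same set).
\<close>

locale left_ideal = additive_subgroup I R + ring R for I and R (structure) +
  assumes l_closed: "\<lbrakk>a \<in> I; x \<in> carrier R\<rbrakk> \<Longrightarrow> x \<otimes> a \<in> I"

locale maximal_left_ideal = left_ideal I R for I and R (structure) +
  assumes notcarr: "carrier R \<noteq> I"
    and maximal: "\<lbrakk>left_ideal J R; I \<subseteq> J\<rbrakk> \<Longrightarrow> J = I \<or> J = carrier R"

definition jacobson_radical :: "('a, 'b) ring_scheme \<Rightarrow> 'a set"
  where "jacobson_radical R = {x \<in> carrier R. \<forall>I. maximal_left_ideal I R \<longrightarrow> x \<in> I}"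

definition sqrt_jacobson_radical :: "('a, 'b) ring_scheme \<Rightarrow> 'a set"
  where "sqrt_jacobson_radical R =
    {z \<in> carrier R. \<exists>k::nat. k \<ge> 1 \<and> z [^]\<^bsub>R\<^esub> k \<in> jacobson_radical R}"

text \<open>
  The locale \<open>ring\<close> admits the zero ring, which is excluded here. No commutation of
  \<open>e\<close> and \<open>z\<close> is required.
\<close>

locale sqrtJ_clean_ring = ring R for R (structure) +
  assumes one_not_zero: "\<one> \<noteq> \<zero>"
    and clean: "x \<in> carrier R \<Longrightarrow>
      \<exists>e \<in> carrier R. \<exists>z \<in> sqrt_jacobson_radical R. e \<otimes> e = e \<and> x = e \<oplus> z"

end

theory Submission
  imports Defs "HOL-Library.Function_Algebras"
begin

text \<open>
  The Jacobson radical of the matrix ring is zero, because the matrices with vanishing \<open>j\<close>-th column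
  form a maximal left ideal for each \<open>j\<close>. So the theorem asks when each matrix is the sum of an
  idempotent and a nilpotent matrix (\<open>sqrtJ_clean_mat_iff\<close>), and an isomorphism with the two-element
  field just says that the division ring has no elements besides \<open>0\<close> and \<open>1\<close>.

  Necessity. Given a scalar \<open>a\<close>, split the matrix \<open>A\<close> with the single entry \<open>a\<close> in the corner as
  \<open>A = E + Z\<close>. Since \<open>A\<close> has rank at most one, the equation \<open>E\<^sup>2 = E\<close> turns into a linear recurrence
  of order two for the corner entries of the powers of \<open>Z\<close>. This sequence starts with \<open>1\<close> and is
  eventually zero, which leaves only \<open>a = 0\<close> and \<open>a = 1\<close> (\<open>corner_nil_clean\<close>). Working with
  these entries reduces the noncommutative case to a computation inside the division ring.

  Sufficiency. Over the two-element field a splitting \<open>f = e + z\<close> on an invariant subspace \<open>W\<close> extends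
  to a larger invariant subspace, obtained by adjoining the orbit of one vector. Modulo \<open>W\<close> this is
  the task of splitting one companion matrix: after a suitable change of the cyclic basis, \<open>z\<close> is the
  shift along the basis and the remainder \<open>e\<close> is idempotent (\<open>nil_clean_extension\<close>). Since \<open>z\<close> moves
  the adjoined vectors into \<open>W\<close> after finitely many steps, it stays nilpotent. Starting from the zero
  subspace, this reaches the whole space.
\<close>

section \<open>The radical of a matrix ring over a division ring\<close>

lemma ring_mat_ring: "ring (ring_mat TYPE('a::ring_1) n b)"
  by unfold_locales
    (use add_inv_exists_mat in \<open>auto simp: ring_mat_def algebra_simps Units_def\<close>)

lemma ring_mat_pow: "A \<in> carrier_mat n n \<Longrightarrow> A [^]\<^bsub>ring_mat TYPE('a::ring_1) n b\<^esub> k = A ^\<^sub>m k"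
  by (induction k) (simp_all add: ring_mat_def nat_pow_def)

lemma left_ideal_zero_column:
  fixes b :: 'b
  assumes "j < n"
  shows "left_ideal {A \<in> carrier_mat n n. \<forall>i<n. A $$ (i, j) = 0} (ring_mat TYPE('a::ring_1) n b)"
    (is "left_ideal ?I ?R")
proof -
  interpret R: ring ?R by (rule ring_mat_ring)
  have uminus: "\<ominus>\<^bsub>?R\<^esub> A = - A" if "A \<in> carrier_mat n n" for A
    by (rule R.minus_equality) (use that in \<open>auto simp: ring_mat_def\<close>)
  have "subgroup ?I (add_monoid ?R)"
  proof (rule R.add.subgroupI)
    show "?I \<noteq> {}" by (auto intro: exI[of _ "0\<^sub>m n n"] simp: assms)
  qed (use assms in \<open>auto simp: ring_mat_simps uminus\<close>)
  moreover have "A * B \<in> ?I" if "B \<in> ?I" "A \<in> carrier_mat n n" for A B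
    using that assms by (auto simp: scalar_prod_def intro!: sum.neutral)
  ultimately show ?thesis
    by (intro left_ideal.intro left_ideal_axioms.intro additive_subgroup.intro R.ring_axioms)
      (auto simp: ring_mat_def)
qed

text \<open>
  The zero-column ideal is the annihilator of a standard basis vector under left multiplication.
  Any larger left ideal contains a matrix whose \<open>j\<close>-th column has an invertible entry; moving this
  entry to the diagonal and scaling it to \<open>1\<close> gives an element that agrees with the identity in
  column \<open>j\<close>, so the identity itself lies in the larger ideal.
\<close>

lemma maximal_left_ideal_zero_column:
  fixes b :: 'b
  assumes j: "j < n"
  shows "maximal_left_ideal {A \<in> carrier_mat n n. \<forall>i<n. A $$ (i, j) = 0}
    (ring_mat TYPE('a::division_ring) n b)"
    (is "maximal_left_ideal ?I ?R")
proof (intro maximal_left_ideal.intro maximal_left_ideal_axioms.intro left_ideal_zero_column j)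
  have "1\<^sub>m n \<in> carrier ?R" "(1\<^sub>m n :: 'a mat) \<notin> ?I" using j by (auto simp: ring_mat_def)
  then show "carrier ?R \<noteq> ?I" by blast
next
  fix L assume L: "left_ideal L ?R" and sub: "?I \<subseteq> L"
  interpret L: left_ideal L ?R by fact
  show "L = ?I \<or> L = carrier ?R"
  proof (cases "L = ?I")
    case False
    then obtain B where BL: "B \<in> L" and "B \<notin> ?I" using sub by blast
    then have B: "B \<in> carrier_mat n n" using L.a_subset by (auto simp: ring_mat_def)
    with \<open>B \<notin> ?I\<close> obtain i where i: "i < n" "B $$ (i, j) \<noteq> 0" by auto
    define C where "C = mat n n (\<lambda>(p, q). if p = j \<and> q = i then inverse (B $$ (i, j)) else 0)"
    have C: "C \<in> carrier_mat n n" by (simp add: C_def)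
    have CB: "(C * B) $$ (p, j) = (if p = j then 1 else 0)" if "p < n" for p
      using that i j B by (simp add: C_def scalar_prod_def sum.remove[of _ i])
    have "1\<^sub>m n - C * B \<in> ?I"
      using CB B C j by (auto simp del: index_mult_mat(1))
    then have "1\<^sub>m n - C * B \<in> L" using sub by blast
    moreover have "C * B \<in> L" using L.l_closed[OF BL, of C] C by (simp add: ring_mat_def)
    ultimately have "(1\<^sub>m n - C * B) + C * B \<in> L"
      using additive_subgroup.a_closed[OF L.additive_subgroup_axioms] by (simp add: ring_mat_def)
    moreover have "(1\<^sub>m n - C * B) + C * B = 1\<^sub>m n" using B C by (intro eq_matI) auto
    ultimately have one: "1\<^sub>m n \<in> L" by simp
    have "X \<in> L" if "X \<in> carrier ?R" for X
      using L.l_closed[OF one that] that by (simp add: ring_mat_def)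
    then show ?thesis using L.a_subset by blast
  qed simp
qed

text \<open>
  A matrix in all the maximal left ideals of matrices with a zero column has all its columns zero.
\<close>

lemma jacobson_radical_mat:
  "jacobson_radical (ring_mat TYPE('a::division_ring) n b) = {0\<^sub>m n n}"
  (is "jacobson_radical ?R = _")
proof (intro equalityI subsetI)
  fix A assume A: "A \<in> jacobson_radical ?R"
  then have "A \<in> carrier_mat n n" by (simp add: jacobson_radical_def ring_mat_def)
  moreover have "A $$ (i, j) = 0" if "i < n" "j < n" for i j
    using A maximal_left_ideal_zero_column[OF that(2), where 'a = 'a and b = b] that(1)
    by (auto simp: jacobson_radical_def)
  ultimately show "A \<in> {0\<^sub>m n n}" by auto
next
  fix A :: "'a mat" assume "A \<in> {0\<^sub>m n n}"
  moreover have "0\<^sub>m n n \<in> I" if "maximal_left_ideal I ?R" for I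
  proof -
    interpret maximal_left_ideal I ?R by fact
    show ?thesis
      using additive_subgroup.zero_closed[OF additive_subgroup_axioms] by (simp add: ring_mat_def)
  qed
  ultimately show "A \<in> jacobson_radical ?R" by (auto simp: jacobson_radical_def ring_mat_def)
qed

text \<open>
  As the radical is zero, \<open>\<surd>J\<close> consists of the nilpotent matrices, and the property to be studied
  becomes the one usually called nil-clean.
\<close>

lemma sqrtJ_clean_mat_iff:
  assumes "0 < n"
  shows "sqrtJ_clean_ring (ring_mat TYPE('a::division_ring) n b) \<longleftrightarrow>
    (\<forall>A \<in> carrier_mat n n. \<exists>E Z :: 'a mat. E \<in> carrier_mat n n \<and> Z \<in> carrier_mat n n \<and>
      E * E = E \<and> A = E + Z \<and> (\<exists>k. Z ^\<^sub>m k = 0\<^sub>m n n))"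
    (is "sqrtJ_clean_ring ?R \<longleftrightarrow> ?nil_clean")
proof -
  interpret R: ring ?R by (rule ring_mat_ring)
  have "(1\<^sub>m n :: 'a mat) $$ (0, 0) \<noteq> 0\<^sub>m n n $$ (0, 0)" using assms by simp
  then have nontriv: "(1\<^sub>m n :: 'a mat) \<noteq> 0\<^sub>m n n" by metis
  have pow_ge_1: "(\<exists>k\<ge>1. Z ^\<^sub>m k = 0\<^sub>m n n) \<longleftrightarrow> (\<exists>k. Z ^\<^sub>m k = 0\<^sub>m n n)"
    if "Z \<in> carrier_mat n n" for Z :: "'a mat"
  proof
    assume "\<exists>k. Z ^\<^sub>m k = 0\<^sub>m n n"
    then obtain k where "Z ^\<^sub>m k = 0\<^sub>m n n" ..
    then have "Z ^\<^sub>m Suc k = 0\<^sub>m n n" using that by simp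
    then show "\<exists>k\<ge>1. Z ^\<^sub>m k = 0\<^sub>m n n" by (intro exI[of _ "Suc k"]) simp
  qed blast
  have rad: "sqrt_jacobson_radical ?R = {Z \<in> carrier_mat n n. \<exists>k. Z ^\<^sub>m k = 0\<^sub>m n n}"
    unfolding sqrt_jacobson_radical_def jacobson_radical_mat
    using pow_ge_1 by (auto simp: ring_mat_pow ring_mat_simps)
  have "sqrtJ_clean_ring ?R \<longleftrightarrow>
    (\<forall>A \<in> carrier ?R. \<exists>E\<in>carrier ?R. \<exists>Z\<in>sqrt_jacobson_radical ?R. E \<otimes>\<^bsub>?R\<^esub> E = E \<and> A = E \<oplus>\<^bsub>?R\<^esub> Z)"
    using nontriv
    by (auto simp: sqrtJ_clean_ring_def sqrtJ_clean_ring_axioms_def R.ring_axioms ring_mat_simps)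
  also have "\<dots> \<longleftrightarrow> ?nil_clean"
    unfolding rad ring_mat_simps by blast
  finally show ?thesis .
qed

section \<open>Corner matrices that split into an idempotent and a nilpotent\<close>

text \<open>
  The recurrence has constant coefficients, multiplied from the right. Let \<open>c\<close> be its lower
  coefficient. If \<open>c\<close> is invertible, the recurrence can be run backwards, so a sequence that is
  eventually zero is zero everywhere, against \<open>z 0 = 1\<close>. Hence \<open>c = 0\<close>, which for \<open>a \<noteq> 0\<close> forces
  \<open>z 1 = a - 1\<close>; then \<open>z\<close> is the sequence of powers of \<open>a - 1\<close>, and \<open>a - 1\<close> is nilpotent.
\<close>

lemma division_ring_linear_recurrence:
  fixes a :: "'a::division_ring" and z :: "nat \<Rightarrow> 'a"
  assumes rec: "\<And>j. z (j + 2) = z (j + 1) * (a - 1) + z j * (a - a * a + a * z 1)"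
    and z0: "z 0 = 1" and ev: "\<And>j. j \<ge> k \<Longrightarrow> z j = 0"
  shows "a = 0 \<or> a = 1"
proof -
  define c where "c = a - a * a + a * z 1"
  have "c = 0"
  proof (rule ccontr)
    assume "c \<noteq> 0"
    have "z (k - i) = 0 \<and> z (Suc (k - i)) = 0" for i
    proof (induction i)
      case 0
      then show ?case using ev by simp
    next
      case (Suc i)
      show ?case
      proof (cases "i < k")
        case True
        then have eq: "k - i = k - Suc i + 1" by simp
        with Suc have "z (k - Suc i + 1) = 0" "z (k - Suc i + 2) = 0" by simp_all
        with rec[of "k - Suc i"] have "z (k - Suc i) * c = 0" by (simp add: c_def)
        with \<open>c \<noteq> 0\<close> show ?thesis using \<open>z (k - Suc i + 1) = 0\<close> by simp
      next
        case False
        then show ?thesis using Suc by simp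
      qed
    qed
    from this[of k] show False using z0 by simp
  qed
  show ?thesis
  proof (cases "a = 0")
    case False
    have "c = a * (1 - a + z 1)" by (simp add: c_def algebra_simps)
    with \<open>c = 0\<close> False have "1 - a + z 1 = 0" by simp
    then have z1: "z 1 = a - 1" by (simp add: algebra_simps eq_neg_iff_add_eq_0)
    have "z (Suc j) = (a - 1) ^ Suc j" for j
    proof (induction j)
      case 0
      then show ?case using z1 by simp
    next
      case (Suc j)
      then show ?case
        using rec[of j] \<open>c = 0\<close> power_Suc2[of "a - 1" "Suc j"] by (simp add: c_def)
    qed
    from this[of k] have "(a - 1) ^ Suc k = 0" using ev[of "Suc k"] by simp
    then show ?thesis by auto
  qed simp
qed

definition corner_mat :: "nat \<Rightarrow> 'a::ring_1 \<Rightarrow> 'a mat"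
  where "corner_mat n a = mat n n (\<lambda>(i, j). if i = 0 \<and> j = 0 then a else 0)"

lemma corner_mat_carrier [simp]: "corner_mat n a \<in> carrier_mat n n"
  by (simp add: corner_mat_def)

lemma mult_corner_mat:
  assumes "M \<in> carrier_mat n n" "0 < n"
  shows "M * corner_mat n a = mat n n (\<lambda>(i, j). if j = 0 then M $$ (i, 0) * a else 0)"
  using assms
  by (intro eq_matI) (auto simp: corner_mat_def scalar_prod_def sum.remove[of _ 0])

text \<open>
  A corner matrix has rank at most one, so the corner entry of a product factors through it.
\<close>

lemma corner_mult_corner:
  assumes "M \<in> carrier_mat n n" "N \<in> carrier_mat n n" "0 < n"
  shows "((M * corner_mat n a) * N) $$ (0, 0) = M $$ (0, 0) * a * N $$ (0, 0)"
  unfolding mult_corner_mat[OF assms(1,3)] using assms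
  by (simp add: scalar_prod_def sum.remove[of _ 0])

text \<open>
  Write \<open>A\<close> for the corner matrix and \<open>z j\<close> for the corner entry of \<open>Z\<^sup>j\<close>. Multiplying the
  idempotency of \<open>E = A - Z\<close> from the left by \<open>Z\<^sup>j\<close> and taking corner entries expresses
  \<open>z (j + 2)\<close> by \<open>z (j + 1)\<close>, \<open>z j\<close> and \<open>z 1\<close>, because \<open>A\<close> has rank at most one. The sequence is
  eventually zero because \<open>Z\<close> is nilpotent.
\<close>

lemma corner_nil_clean:
  fixes E Z :: "'a::division_ring mat"
  assumes E: "E \<in> carrier_mat n n" "E * E = E" and Z: "Z \<in> carrier_mat n n" "Z ^\<^sub>m k = 0\<^sub>m n n"
    and n: "0 < n" and A: "corner_mat n a = E + Z"
  shows "a = 0 \<or> a = 1"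
proof (rule division_ring_linear_recurrence[where z = "\<lambda>j. (Z ^\<^sub>m j) $$ (0, 0)"])
  define A where "A = corner_mat n a"
  let ?z = "\<lambda>j. (Z ^\<^sub>m j) $$ (0, 0)"
  have cA: "A \<in> carrier_mat n n" by (simp add: A_def)
  have E_eq: "E = A - Z" using A E(1) Z(1) unfolding A_def by auto
  show "?z 0 = 1" using n Z(1) by simp
  show "?z j = 0" if "j \<ge> k" for j
    using that
  proof (induction j rule: dec_induct)
    case base
    then show ?case using Z(2) n by simp
  next
    case (step j)
    have "Z ^\<^sub>m (k + i) = 0\<^sub>m n n" for i
      by (induction i) (use Z in simp_all)
    from this[of "Suc j - k"] step show ?case using n by simp
  qed
  show "?z (j + 2) = ?z (j + 1) * (a - 1) + ?z j * (a - a * a + a * ?z 1)" for j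
  proof -
    define M where "M = Z ^\<^sub>m j"
    have cM: "M \<in> carrier_mat n n" using Z(1) by (simp add: M_def)
    note c = cA cM Z(1)
    have z: "?z j = M $$ (0,0)" "?z (j + 1) = (M * Z) $$ (0,0)" "?z (j + 2) = (M * Z * Z) $$ (0,0)"
      by (simp_all add: M_def)
    have z1: "?z 1 = Z $$ (0,0)" using Z(1) by simp
    have "(M * E) * E = M * E" using E cM by simp
    moreover have ME: "M * E = M * A - M * Z"
      unfolding E_eq using c by (simp add: mult_minus_distrib_mat)
    moreover have "(M * A - M * Z) * E = (M * A * A - M * A * Z) - (M * Z * A - M * Z * Z)"
      unfolding E_eq using c
      by (simp only: mult_minus_distrib_mat[of _ n n _ n] minus_mult_distrib_mat[of _ n n _ _ n]
          mult_carrier_mat minus_carrier_mat[of _ n n]) auto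
    ultimately have "((M * A * A - M * A * Z) - (M * Z * A - M * Z * Z)) $$ (0,0) = (M * A - M * Z) $$ (0,0)"
      by simp
    then have eq: "((M * A * A) $$ (0,0) - (M * A * Z) $$ (0,0)) - ((M * Z * A) $$ (0,0) - (M * Z * Z) $$ (0,0))
       = (M * A) $$ (0,0) - (M * Z) $$ (0,0)"
      using c n by (simp del: index_mult_mat(1) assoc_mult_mat)
    have ent: "(N * A) $$ (0,0) = N $$ (0,0) * a" if "N \<in> carrier_mat n n" for N
      unfolding A_def mult_corner_mat[OF that n] using n by simp
    have MAZ: "(M * A * Z) $$ (0,0) = M $$ (0,0) * a * Z $$ (0,0)"
      unfolding A_def by (rule corner_mult_corner[OF cM Z(1) n])
    have "M $$ (0,0) * a * a - M $$ (0,0) * a * Z $$ (0,0) - ((M * Z) $$ (0,0) * a - (M * Z * Z) $$ (0,0))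
       = M $$ (0,0) * a - (M * Z) $$ (0,0)"
      using eq unfolding MAZ using ent[of M] ent[of "M * A"] ent[of "M * Z"] c by (simp del: index_mult_mat(1) assoc_mult_mat)
    then show ?thesis unfolding z z1 by (simp add: algebra_simps del: index_mult_mat(1) assoc_mult_mat)
  qed
qed

section \<open>Splitting linear maps over the two-element field\<close>

lemma (in vector_space) linear_extend_by_one:
  assumes e: "Vector_Spaces.linear scale scale e" and x: "x \<notin> span S"
  shows "\<exists>e'. Vector_Spaces.linear scale scale e' \<and> (\<forall>w\<in>span S. e' w = e w) \<and> e' x = y"
proof -
  interpret vs: vector_space_pair scale scale ..
  obtain B where B: "B \<subseteq> span S" "independent B" "span S \<subseteq> span B"
    using maximal_independent_subset[of "span S"] by blast
  have xB: "x \<notin> span B"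
    using x B(1) span_minimal by blast
  have "independent (insert x B)"
    using B(2) xB by (simp add: independent_insert)
  from vs.linear_independent_extend[OF this, of "\<lambda>b. if b = x then y else e b"]
  obtain e' where e': "Vector_Spaces.linear scale scale e'"
    "\<forall>b\<in>insert x B. e' b = (if b = x then y else e b)" by blast
  have "e' b = e b" if "b \<in> B" for b
    using e'(2) that xB span_base by auto
  then have "e' w = e w" if "w \<in> span S" for w
    using vs.linear_eq_on_span[OF e'(1) e, of B w] that B(3) by blast
  then show ?thesis using e' by auto
qed

text \<open>
  A linear map can be prescribed freely on a sequence that is independent modulo a subspace, without
  changing it on that subspace. This replaces an explicit choice of basis.
\<close>

lemma (in vector_space) linear_extend_by_sequence:
  assumes e: "Vector_Spaces.linear scale scale e"
    and w: "\<forall>i<m::nat. w i \<notin> span (S \<union> w ` {..<i})"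
  shows "\<exists>e'. Vector_Spaces.linear scale scale e' \<and> (\<forall>x\<in>span S. e' x = e x) \<and>
    (\<forall>i<m. e' (w i) = y i)"
  using w
proof (induction m)
  case 0
  then show ?case using e by auto
next
  case (Suc m)
  then obtain e1 where e1: "Vector_Spaces.linear scale scale e1" "\<forall>x\<in>span S. e1 x = e x"
    "\<forall>i<m. e1 (w i) = y i" by (metis less_Suc_eq)
  have "w m \<notin> span (S \<union> w ` {..<m})" using Suc.prems by simp
  from linear_extend_by_one[OF e1(1) this] obtain e2
    where e2: "Vector_Spaces.linear scale scale e2"
      "\<forall>x\<in>span (S \<union> w ` {..<m}). e2 x = e1 x" "e2 (w m) = y m" by blast
  have "span S \<subseteq> span (S \<union> w ` {..<m})" by (rule span_mono) auto
  moreover have "w i \<in> span (S \<union> w ` {..<m})" if "i < m" for i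
    using that by (intro span_base) auto
  ultimately show ?case using e1 e2 by (intro exI[of _ e2]) (auto simp: less_Suc_eq)
qed

locale bit_vector_space = vector_space scale for scale :: "bit \<Rightarrow> 'v::ab_group_add \<Rightarrow> 'v"
begin

sublocale vector_space_pair scale scale ..

abbreviation lin :: "('v \<Rightarrow> 'v) \<Rightarrow> bool"
  where "lin \<equiv> Vector_Spaces.linear scale scale"

lemma double_zero: "x + x = (0::'v)"
proof -
  have "x + x = scale (1 + 1) x" by (simp only: scale_left_distrib scale_one)
  then show ?thesis by simp
qed

lemma minus_eq_plus: "x - y = x + (y::'v)"
  using minus_unique[OF double_zero, of y] by simp

lemma lin_if_additive:
  assumes "\<And>x y. f (x + y) = f x + f y"
  shows "lin f"
proof -
  have "f 0 = 0" using assms[of 0 0] by simp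
  then have "f (scale c x) = scale c (f x)" for c x
    by (cases c) auto
  then show ?thesis
    by unfold_locales (simp_all add: assms)
qed

text \<open>
  Over the two-element field a linear combination is a sum over a subset of the generators.
\<close>

lemma span_union_image:
  assumes W: "subspace W" and "x \<in> span (W \<union> u ` {..<m::nat})"
  shows "\<exists>w\<in>W. \<exists>K\<subseteq>{..<m}. x = w + (\<Sum>k\<in>K. u k)"
  using assms(2)
proof (induction m arbitrary: x)
  case 0
  then show ?case using W by (auto simp: span_eq_iff[THEN iffD2])
next
  case (Suc m)
  have "W \<union> u ` {..<Suc m} = insert (u m) (W \<union> u ` {..<m})"
    by (auto simp: lessThan_Suc)
  with Suc.prems obtain c where "x - scale c (u m) \<in> span (W \<union> u ` {..<m})"
    by (auto simp: span_breakdown_eq)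
  with Suc.IH obtain w K where wK: "w \<in> W" "K \<subseteq> {..<m}"
    "x - scale c (u m) = w + (\<Sum>k\<in>K. u k)" by blast
  show ?case
  proof (cases c)
    case zero
    then show ?thesis using wK by (intro bexI[of _ w] exI[of _ K]) auto
  next
    case one
    have "finite K" "m \<notin> K" using wK(2) finite_subset by auto
    then have "x = w + (\<Sum>k\<in>insert m K. u k)"
      using wK(3) one by (simp add: algebra_simps)
    then show ?thesis using wK by (intro bexI[of _ w] exI[of _ "insert m K"]) auto
  qed
qed

text \<open>
  The map \<open>e\<close> is total and linear everywhere, but idempotency of \<open>e\<close> and nilpotency of \<open>f - e\<close> are
  required on the invariant subspace only. Growing the subspace then only asks for changing \<open>e\<close>
  outside of it.
\<close>

definition nil_clean_on :: "('v \<Rightarrow> 'v) \<Rightarrow> 'v set \<Rightarrow> ('v \<Rightarrow> 'v) \<Rightarrow> bool"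
  where "nil_clean_on f W e \<longleftrightarrow> lin e \<and> e ` W \<subseteq> W \<and> (\<forall>x\<in>W. e (e x) = e x) \<and>
    (\<exists>k. \<forall>x\<in>W. ((\<lambda>x. f x - e x) ^^ k) x = 0)"

lemma lin_funpow: "lin f \<Longrightarrow> lin (f ^^ k)"
  by (induction k) (auto intro: Vector_Spaces.linear_compose linear_id)

text \<open>
  Let \<open>u i = f\<^sup>i v\<close>, and let \<open>m\<close> be least with \<open>u m\<close> in the span of \<open>W\<close> and the earlier \<open>u i\<close>, say
  \<open>u m = w0 + (\<Sum>k\<in>K. u k)\<close>. Modulo \<open>W\<close> the map \<open>f\<close> is the companion matrix of the polynomial
  \<open>t\<^sup>m + (\<Sum>k\<in>K. t\<^sup>k)\<close>, and one has to split this companion matrix.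

  The idea is to pick a new basis \<open>w i\<close> of the cyclic part such that the nilpotent part is the plain
  shift \<open>w 0 \<mapsto> w 1 \<mapsto> \<dots> \<mapsto> w (m - 1) \<mapsto> w0 \<in> W\<close> and the remainder \<open>e' = f - shift\<close> is idempotent. With
  \<open>j = Max K\<close>, the vectors \<open>w i = u i\<close> for \<open>i \<le> j\<close> and \<open>w i = u i + u (i - 1)\<close> for \<open>i > j\<close> do this:
  the remainder fixes \<open>w j\<close> in case \<open>j < m - 1\<close>, sends \<open>w (m - 1)\<close> to itself plus some of the
  vectors that it kills, and kills all other \<open>w i\<close>. In that case the image of \<open>w (m - 1)\<close> is
  \<open>u m + u (m - 1) + w0\<close>, the sum of the \<open>u k\<close> with \<open>k \<in> K\<close>, \<open>k < j\<close> and of \<open>u j + u (m - 1)\<close>. The former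
  equal \<open>w k\<close>, and the latter telescopes into \<open>w (j + 1) + \<dots> + w (m - 1)\<close>, so \<open>w j\<close> does not occur;
  this is why \<open>j\<close> is the largest exponent in \<open>K\<close>.

  If \<open>K\<close> is empty the shift of the \<open>u i\<close> itself is nilpotent modulo
  \<open>W\<close>, and \<open>e'\<close> vanishes on the new vectors.
\<close>

lemma nil_clean_extension:
  assumes f: "lin f" and W: "subspace W" and fW: "f ` W \<subseteq> W" and e: "nil_clean_on f W e"
    and V: "subspace V" "finite V" "W \<subseteq> V" "f ` V \<subseteq> V" and v: "v \<in> V" "v \<notin> W"
  shows "\<exists>W' e'. subspace W' \<and> W \<subset> W' \<and> W' \<subseteq> V \<and> f ` W' \<subseteq> W' \<and> nil_clean_on f W' e'"
proof -
  define u where "u = (\<lambda>i. (f ^^ i) v)"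
  define S where "S = (\<lambda>i. span (W \<union> u ` {..<i}))"
  have u_Suc: "f (u i) = u (Suc i)" for i by (simp add: u_def)
  have uV: "u i \<in> V" for i
    by (induction i) (use v V(4) in \<open>auto simp: u_def\<close>)
  have "\<not> inj u"
    using V(2) uV finite_subset[of "range u" V] by (meson finite_imageD image_subset_iff infinite_UNIV_nat)
  then obtain p q where "p < q" "u p = u q"
    by (metis injI linorder_neqE_nat)
  then have "u q \<in> S q" unfolding S_def by (metis UnCI imageI lessThan_iff span_base)
  then have ex: "\<exists>q. u q \<in> S q" by blast
  define m where "m = (LEAST q. u q \<in> S q)"
  have um: "u m \<in> S m" unfolding m_def using ex by (rule LeastI_ex)
  have u_notin: "u i \<notin> S i" if "i < m" for i
    using that not_less_Least unfolding m_def by blast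
  have "S 0 = W" using W by (simp add: S_def span_eq_iff[THEN iffD2])
  then have m0: "m > 0" using um v(2) by (intro gr0I) (auto simp: u_def)
  obtain w0 K where w0: "w0 \<in> W" and K: "K \<subseteq> {..<m}" and um_eq: "u m = w0 + (\<Sum>k\<in>K. u k)"
    using span_union_image[OF W um[unfolded S_def]] by blast
  have finK: "finite K" using K finite_subset by blast
  \<comment> \<open>For empty \<open>K\<close>, the value \<open>m\<close> makes \<open>w i = u i\<close> for all \<open>i < m\<close>.\<close>
  define j where "j = (if K = {} then m else Max K)"
  have jK: "j \<in> K" "\<And>k. k \<in> K \<Longrightarrow> k \<le> j" if "K \<noteq> {}"
    using that finK by (auto simp: j_def)
  define w where "w = (\<lambda>i. if i \<le> j then u i else u i + u (i - 1))"

  have u_in_S: "u k \<in> S i" if "k < i" for k i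
    unfolding S_def using that by (intro span_base) auto
  have w_in_S: "w k \<in> S i" if "k < i" for k i
    using u_in_S[OF that] u_in_S[of "k - 1" i] that span_add unfolding S_def w_def by auto
  have "span (W \<union> w ` {..<i}) \<subseteq> S i" for i
  proof (rule span_minimal)
    show "W \<union> w ` {..<i} \<subseteq> S i"
      using w_in_S by (auto simp: S_def intro: span_base)
  qed (simp add: S_def)
  moreover have "w i \<notin> S i" if "i < m" for i
  proof
    assume wi: "w i \<in> S i"
    have "u i \<in> S i"
    proof (cases "i \<le> j")
      case True
      then show ?thesis using wi by (simp add: w_def)
    next
      case False
      then have "u i = w i - u (i - 1)" by (simp add: w_def)
      moreover have "u (i - 1) \<in> S i" using False by (intro u_in_S) simp
      ultimately show ?thesis using wi span_diff unfolding S_def by metis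
    qed
    then show False using u_notin[OF that] by simp
  qed
  ultimately have w_indep: "\<forall>i<m. w i \<notin> span (W \<union> w ` {..<i})" by blast

  define next_w where "next_w = (\<lambda>i. if Suc i < m then w (Suc i) else w0)"
  \<comment> \<open>The prescribed values of \<open>e'\<close>: in characteristic two, \<open>t i\<close> is also the difference of
      \<open>f (w i)\<close> and the image of \<open>w i\<close> under the shift.\<close>
  define t where "t = (\<lambda>i. f (w i) + next_w i)"
  from e have le: "lin e" by (simp add: nil_clean_on_def)
  from linear_extend_by_sequence[OF le w_indep, of t] obtain e'
    where e': "lin e'" "\<forall>x\<in>span W. e' x = e x" and e'w: "\<forall>i<m. e' (w i) = t i" by blast
  have e'W: "e' x = e x" if "x \<in> W" for x
    using e'(2) that span_base by blast
  define W' where "W' = span (W \<union> w ` {..<m})"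
  have W'_W: "x \<in> W'" if "x \<in> W" for x
    using that unfolding W'_def by (intro span_base) auto
  have W'_w: "w i \<in> W'" if "i < m" for i
    using that unfolding W'_def by (intro span_base) auto
  have subW': "subspace W'" by (simp add: W'_def)

  have fw: "f (w i) = (if i \<le> j then u (Suc i) else u (Suc i) + u i)" for i
    using linear_add[OF f] by (simp add: w_def u_Suc)
  have t_zero: "t i = 0" if "Suc i < m" "i \<noteq> j" for i
    using that double_zero by (auto simp: t_def next_w_def fw) (auto simp: w_def double_zero)
  have t_j: "t j = w j" if "Suc j < m"
  proof -
    have "t j = (u (Suc j) + u (Suc j)) + u j"
      using that by (simp add: t_def next_w_def fw) (simp add: w_def add.assoc)
    then show ?thesis by (simp add: double_zero w_def)
  qed
  have t_last_nil: "t (m - 1) = 0" if "K = {}"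
    using that m0 um_eq double_zero by (simp add: t_def next_w_def fw j_def)
  have t_last: "\<exists>L \<subseteq> {..<m - 1} - {j}. t (m - 1) = w (m - 1) + (\<Sum>k\<in>L. w k)" if "K \<noteq> {}"
  proof -
    have jm: "j < m" using jK[OF that] K by auto
    have sumK: "(\<Sum>k\<in>K. u k) = u j + (\<Sum>k\<in>K - {j}. w k)"
    proof -
      have "(\<Sum>k\<in>K. u k) = u j + (\<Sum>k\<in>K - {j}. u k)"
        using jK(1)[OF that] finK by (simp add: sum.remove)
      also have "(\<Sum>k\<in>K - {j}. u k) = (\<Sum>k\<in>K - {j}. w k)"
        using jK(2)[OF that] by (intro sum.cong) (auto simp: w_def)
      finally show ?thesis .
    qed
    have um_w0: "u m + w0 = (\<Sum>k\<in>K. u k)"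
    proof -
      have "u m + w0 = (w0 + w0) + (\<Sum>k\<in>K. u k)" unfolding um_eq by (simp only: ac_simps)
      then show ?thesis by (simp add: double_zero)
    qed
    have Kj: "K - {j} \<subseteq> {..<j}" using jK(2)[OF that] by (auto simp: order.strict_iff_order)
    show ?thesis
    proof (cases "j = m - 1")
      case True
      have "t (m - 1) = u m + w0"
        using m0 by (simp add: t_def next_w_def fw True)
      also have "\<dots> = w (m - 1) + (\<Sum>k\<in>K - {j}. w k)"
        unfolding um_w0 sumK by (simp add: w_def True)
      finally show ?thesis using Kj True by blast
    next
      case False
      then have jm': "j < m - 1" using jm by simp
      have telescope: "(\<Sum>k\<in>{Suc j..<p}. w k) = u j + u (p - 1)" if "j < p" for p
        using that
      proof (induction p)
        case (Suc p)
        show ?case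
        proof (cases "p = j")
          case True
          then show ?thesis by (simp add: double_zero)
        next
          case False
          then have "j < p" using Suc.prems by simp
          then have "(\<Sum>k\<in>{Suc j..<Suc p}. w k) = (u j + u (p - 1)) + (u p + u (p - 1))"
            using Suc.IH by (simp add: w_def)
          also have "\<dots> = u j + u p + (u (p - 1) + u (p - 1))" by (simp only: ac_simps)
          finally show ?thesis by (simp add: double_zero)
        qed
      qed simp
      have "t (m - 1) = (u m + w0) + u (m - 1)"
        using jm' by (simp add: t_def next_w_def fw ac_simps)
      also have "\<dots> = (\<Sum>k\<in>{Suc j..<m}. w k) + (\<Sum>k\<in>K - {j}. w k)"
        unfolding um_w0 sumK telescope[OF jm] by (simp only: ac_simps)
      also have "(\<Sum>k\<in>{Suc j..<m}. w k) = w (m - 1) + (\<Sum>k\<in>{Suc j..<m - 1}. w k)"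
        using jm' sum.atLeastLessThan_Suc[of "Suc j" "m - 1" w] by (simp add: add.commute)
      also have "\<dots> + (\<Sum>k\<in>K - {j}. w k) = w (m - 1) + (\<Sum>k\<in>{Suc j..<m - 1} \<union> (K - {j}). w k)"
        using Kj finK by (subst sum.union_disjoint) (auto simp: add.assoc)
      finally show ?thesis using Kj jm' by (intro exI[of _ "{Suc j..<m - 1} \<union> (K - {j})"]) auto
    qed
  qed
  \<comment> \<open>The sum runs over indices at which \<open>t\<close> vanishes, and this yields idempotency.\<close>
  have t_cases: "t i = 0 \<or> (\<exists>L \<subseteq> {..<m - 1} - {j}. t i = w i + (\<Sum>k\<in>L. w k))" if "i < m" for i
  proof (cases "Suc i < m")
    case True
    then show ?thesis using t_zero t_j by (cases "i = j") (auto intro: exI[of _ "{}"])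
  next
    case False
    then have "i = m - 1" using that by simp
    then show ?thesis using t_last_nil t_last by blast
  qed
  have t_W': "t i \<in> W'" and e'_t: "e' (t i) = t i" if i: "i < m" for i
  proof -
    consider "t i = 0" | L where "L \<subseteq> {..<m - 1} - {j}" "t i = w i + (\<Sum>k\<in>L. w k)"
      using t_cases[OF i] by blast
    then have "t i \<in> W' \<and> e' (t i) = t i"
    proof cases
      case 1
      then show ?thesis using subspace_0[OF subW'] linear_0[OF e'(1)] by simp
    next
      case 2
      have e'0: "e' (w k) = 0" if "k \<in> L" for k
      proof -
        have "Suc k < m" "k \<noteq> j" using that 2(1) by auto
        then show ?thesis using e'w t_zero by simp
      qed
      have "e' (t i) = e' (w i) + (\<Sum>k\<in>L. e' (w k))"
        unfolding 2(2) by (simp only: linear_add[OF e'(1)] linear_sum[OF e'(1)])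
      then have "e' (t i) = t i" using e'0 e'w i by simp
      moreover have "t i \<in> W'"
        unfolding 2(2) using 2(1) i by (intro subspace_add subspace_sum subW' W'_w) auto
      ultimately show ?thesis by simp
    qed
    then show "t i \<in> W'" "e' (t i) = t i" by auto
  qed

  have next_W': "next_w i \<in> W'" for i
    using W'_w W'_W w0 by (simp add: next_w_def)
  have fw_W': "f (w i) \<in> W'" if "i < m" for i
  proof -
    have "f (w i) = t i - next_w i" by (simp add: t_def)
    then show ?thesis using subspace_diff[OF subW' t_W'[OF that] next_W'] by simp
  qed
  have preserve: "g ` W' \<subseteq> W'" if "lin g" "\<And>x. x \<in> W \<Longrightarrow> g x \<in> W'" "\<And>i. i < m \<Longrightarrow> g (w i) \<in> W'" for g
  proof -
    have "g ` W' = span (g ` (W \<union> w ` {..<m}))"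
      unfolding W'_def by (simp add: linear_span_image[OF that(1)])
    also have "\<dots> \<subseteq> W'"
      using that(2,3) by (intro span_minimal subW') auto
    finally show ?thesis .
  qed
  have fW': "f ` W' \<subseteq> W'"
    using fW W'_W fw_W' by (intro preserve f) auto
  have eW: "e x \<in> W" if "x \<in> W" for x
    using e that by (auto simp: nil_clean_on_def)
  have e'W': "e' ` W' \<subseteq> W'"
    using e'W e'w eW W'_W t_W' by (intro preserve e') auto
  have idem: "e' (e' x) = e' x" if "x \<in> W'" for x
  proof -
    have "(e' \<circ> e') x = e' x"
    proof (rule linear_eq_on_span[OF Vector_Spaces.linear_compose[OF e'(1) e'(1)] e'(1)])
      show "x \<in> span (W \<union> w ` {..<m})" using that by (simp add: W'_def)
      fix b assume "b \<in> W \<union> w ` {..<m}"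
      then show "(e' \<circ> e') b = e' b"
        using e'W eW e e'w e'_t by (auto simp: nil_clean_on_def)
    qed
    then show ?thesis by simp
  qed

  define z where "z = (\<lambda>x. f x - e' x)"
  have lz: "lin (z ^^ i)" for i
    unfolding z_def using linear_compose_sub[OF f e'(1)] by (rule lin_funpow)
  obtain k where k: "\<And>x. x \<in> W \<Longrightarrow> ((\<lambda>x. f x - e x) ^^ k) x = 0"
    using e by (auto simp: nil_clean_on_def)
  have "(z ^^ i) x = ((\<lambda>x. f x - e x) ^^ i) x \<and> (z ^^ i) x \<in> W" if "x \<in> W" for x i
  proof (induction i)
    case (Suc i)
    then have "(z ^^ i) x \<in> W" ..
    then have "z ((z ^^ i) x) \<in> W" "z ((z ^^ i) x) = f ((z ^^ i) x) - e ((z ^^ i) x)"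
      using fW eW e'W subspace_diff[OF W] by (auto simp: z_def)
    moreover have "(z ^^ i) x = ((\<lambda>x. f x - e x) ^^ i) x" using Suc ..
    ultimately show ?case by (metis comp_apply funpow.simps(2))
  qed (use that in simp)
  then have zW: "(z ^^ k) x = 0" if "x \<in> W" for x
    using k that by metis
  have zw: "z (w i) = next_w i" if "i < m" for i
    using that e'w double_zero[of "f (w i)"]
    by (simp add: z_def t_def minus_eq_plus flip: add.assoc)
  \<comment> \<open>The shift needs \<open>d + 1\<close> steps from \<open>w (m - 1 - d)\<close> into \<open>W\<close>, where \<open>k\<close> more steps reach zero.\<close>
  have z_chain: "(z ^^ (k + Suc d)) (w (m - Suc d)) = 0" if "d < m" for d
    using that
  proof (induction d)
    case 0
    have "z (w (m - 1)) = w0" using zw[of "m - 1"] 0 by (simp add: next_w_def)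
    then show ?case using zW[OF w0] by (simp add: funpow_Suc_right del: funpow.simps)
  next
    case (Suc d)
    have "z (w (m - Suc (Suc d))) = w (m - Suc d)"
      using zw[of "m - Suc (Suc d)"] Suc.prems by (simp add: next_w_def Suc_diff_Suc)
    moreover have "(z ^^ (k + Suc (Suc d))) y = (z ^^ (k + Suc d)) (z y)" for y
      by (simp only: add_Suc_right[of k "Suc d"] funpow_Suc_right comp_apply)
    ultimately show ?case using Suc by simp
  qed
  have "(z ^^ (k + m)) x = 0" if "x \<in> W'" for x
  proof (rule linear_eq_0_on_span[OF lz])
    show "x \<in> span (W \<union> w ` {..<m})" using that by (simp add: W'_def)
    fix b assume "b \<in> W \<union> w ` {..<m}"
    then consider "b \<in> W" | i where "i < m" "b = w i" by auto
    then show "(z ^^ (k + m)) b = 0"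
    proof cases
      case 1
      then show ?thesis
        using zW linear_0[OF lz] by (simp add: add.commute[of k] funpow_add)
    next
      case 2
      then have "b = w (m - Suc (m - Suc i))" "m - Suc i < m" by auto
      then have "(z ^^ (k + Suc (m - Suc i))) b = 0"
        using z_chain[of "m - Suc i"] by simp
      moreover have "k + m = i + (k + Suc (m - Suc i))" using 2 by simp
      ultimately show ?thesis
        using linear_0[OF lz] by (metis comp_apply funpow_add)
    qed
  qed
  then have "nil_clean_on f W' e'"
    unfolding nil_clean_on_def z_def[symmetric] using e'(1) e'W' idem by auto
  moreover have "W \<subset> W'"
  proof -
    have "w 0 = v" by (simp add: w_def u_def)
    then have "v \<in> W'" using W'_w[OF m0] by simp
    then show ?thesis using W'_W v(2) by blast
  qed
  moreover have "W' \<subseteq> V"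
    unfolding W'_def
  proof (rule span_minimal[OF _ V(1)])
    have "w i \<in> V" for i using uV subspace_add[OF V(1)] by (simp add: w_def)
    then show "W \<union> w ` {..<m} \<subseteq> V" using V(3) by auto
  qed
  ultimately show ?thesis
    using subW' fW' by (intro exI[of _ W'] exI[of _ e'] conjI)
qed

text \<open>
  A maximal invariant subspace on which \<open>f\<close> splits is the whole space by the extension lemma.
\<close>

theorem finite_nil_clean:
  assumes f: "lin f" and V: "subspace V" "finite V" "f ` V \<subseteq> V"
  shows "\<exists>e. nil_clean_on f V e"
proof -
  define F where "F = {W. subspace W \<and> W \<subseteq> V \<and> f ` W \<subseteq> W \<and> (\<exists>e. nil_clean_on f W e)}"
  have "nil_clean_on f {0} (\<lambda>x. 0)"
    unfolding nil_clean_on_def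
  proof (intro conjI exI[of _ 1])
    show "lin (\<lambda>x. 0)" by (rule lin_if_additive) simp
  qed (simp_all add: linear_0[OF f])
  then have "\<exists>e. nil_clean_on f {0} e" by (rule exI[of "nil_clean_on f {0}"])
  then have mem: "{0} \<in> F"
    using subspace_0[OF V(1)] by (simp add: F_def linear_0[OF f])
  have "F \<subseteq> Pow V" by (rule subsetI) (simp add: F_def)
  then have "finite F" using V(2) by (simp add: finite_subset)
  from finite_has_maximal2[OF this mem]
  obtain W where "W \<in> F" and max: "\<forall>W'\<in>F. W \<subseteq> W' \<longrightarrow> W = W'" by metis
  from this(1) obtain e where W: "subspace W" "W \<subseteq> V" "f ` W \<subseteq> W" and e: "nil_clean_on f W e"
    by (auto simp: F_def)
  have "W = V"
  proof (rule ccontr)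
    assume "W \<noteq> V"
    then obtain v where v: "v \<in> V" "v \<notin> W" using W(2) by blast
    obtain W' e' where W': "subspace W'" "W \<subset> W'" "W' \<subseteq> V" "f ` W' \<subseteq> W'" "nil_clean_on f W' e'"
      using nil_clean_extension[OF f W(1,3) e V(1,2) W(2) V(3) v] by blast
    then have "W' \<in> F" unfolding F_def by blast
    then show False using max W'(2) by blast
  qed
  then show ?thesis using e by blast
qed

end

section \<open>Matrices over a two-element ring\<close>

text \<open>
  An abelian group of exponent two is a vector space over the two-element field in exactly one way.
  This makes the coordinate vectors over a two-element ring a space over \<^typ>\<open>bit\<close> without
  transporting matrices along an isomorphism of the coefficients.
\<close>

definition bit_scale :: "bit \<Rightarrow> 'v \<Rightarrow> 'v::ab_group_add"
  where "bit_scale c x = (if c = 1 then x else 0)"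

lemma bit_vector_space_bit_scale:
  assumes "\<And>x :: 'v::ab_group_add. x + x = 0"
  shows "bit_vector_space (bit_scale :: bit \<Rightarrow> 'v \<Rightarrow> 'v)"
proof
  fix a b :: bit and x y :: 'v
  show "bit_scale a (x + y) = bit_scale a x + bit_scale a y"
    "bit_scale a (bit_scale b x) = bit_scale (a * b) x" "bit_scale 1 x = x"
    by (auto simp: bit_scale_def)
  show "bit_scale (a + b) x = bit_scale a x + bit_scale b x"
    using assms[of x] by (cases a; cases b) (auto simp: bit_scale_def)
qed

text \<open>
  Column vectors of length \<open>n\<close> are represented as functions supported on the indices below \<open>n\<close>, so
  that they live in an additive group type, as the vector space locales demand.
\<close>

definition mat_action :: "'a::semiring_1 mat \<Rightarrow> (nat \<Rightarrow> 'a) \<Rightarrow> (nat \<Rightarrow> 'a)"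
  where "mat_action A x = (\<lambda>i. if i < dim_row A then \<Sum>k<dim_col A. A $$ (i, k) * x k else 0)"

definition coord_vectors :: "nat \<Rightarrow> (nat \<Rightarrow> 'a::zero) set"
  where "coord_vectors n = {x. \<forall>i\<ge>n. x i = 0}"

definition coord_unit :: "nat \<Rightarrow> nat \<Rightarrow> 'a::zero_neq_one"
  where "coord_unit k = (\<lambda>i. if i = k then 1 else 0)"

lemma mat_action_mult:
  assumes "A \<in> carrier_mat n n" "B \<in> carrier_mat n n"
  shows "mat_action (A * B) x = mat_action A (mat_action B x)"
proof
  fix i
  show "mat_action (A * B) x i = mat_action A (mat_action B x) i"
  proof (cases "i < n")
    case True
    have "mat_action (A * B) x i = (\<Sum>k<n. \<Sum>l<n. A $$ (i, l) * B $$ (l, k) * x k)"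
      using True assms
      by (auto simp: mat_action_def scalar_prod_def sum_distrib_right lessThan_atLeast0 intro!: sum.cong)
    also have "\<dots> = (\<Sum>l<n. \<Sum>k<n. A $$ (i, l) * B $$ (l, k) * x k)"
      by (rule sum.swap)
    also have "\<dots> = mat_action A (mat_action B x) i"
      using True assms
      by (auto simp: mat_action_def sum_distrib_left mult.assoc intro!: sum.cong)
    finally show ?thesis .
  qed (use assms in \<open>simp add: mat_action_def\<close>)
qed

lemma mat_action_unit:
  assumes "i < dim_row A" "k < dim_col A"
  shows "mat_action A (coord_unit k) i = A $$ (i, k)"
proof -
  have "(\<Sum>l<dim_col A. A $$ (i, l) * coord_unit k l) = (\<Sum>l<dim_col A. if l = k then A $$ (i, l) else 0)"
    by (rule sum.cong) (auto simp: coord_unit_def)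
  then show ?thesis using assms by (simp add: mat_action_def)
qed

lemma coord_unit_coord_vectors: "k < n \<Longrightarrow> coord_unit k \<in> coord_vectors n"
  by (auto simp: coord_unit_def coord_vectors_def)

lemma mat_action_coord_vectors: "A \<in> carrier_mat n m \<Longrightarrow> mat_action A x \<in> coord_vectors n"
  by (auto simp: mat_action_def coord_vectors_def)

lemma mat_eqI_action:
  assumes "A \<in> carrier_mat n n" "B \<in> carrier_mat n n"
    and "\<And>x. x \<in> coord_vectors n \<Longrightarrow> mat_action A x = mat_action B x"
  shows "A = B"
proof (rule eq_matI)
  fix i k assume "i < dim_row B" "k < dim_col B"
  then show "A $$ (i, k) = B $$ (i, k)"
    using assms mat_action_unit[of i A k] mat_action_unit[of i B k]
    by (simp add: coord_unit_coord_vectors)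
qed (use assms in auto)

lemma mat_action_add: "mat_action A (x + y) = mat_action A x + mat_action A y"
  by (auto simp: mat_action_def fun_eq_iff distrib_left sum.distrib)

lemma mat_action_pow:
  "A \<in> carrier_mat n n \<Longrightarrow> x \<in> coord_vectors n \<Longrightarrow> mat_action (A ^\<^sub>m k) x = (mat_action A ^^ k) x"
proof (induction k arbitrary: x)
  case 0
  have "mat_action (1\<^sub>m n) x i = x i" for i
  proof (cases "i < n")
    case True
    have "(\<Sum>k<n. 1\<^sub>m n $$ (i, k) * x k) = (\<Sum>k<n. if k = i then x k else 0)"
      using True by (intro sum.cong) auto
    then show ?thesis using True by (simp add: mat_action_def)
  qed (use 0 in \<open>simp add: mat_action_def coord_vectors_def\<close>)
  then show ?case using 0 by auto
next
  case (Suc k)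
  then show ?case
    by (simp add: mat_action_mult[of _ n] mat_action_coord_vectors funpow_Suc_right del: funpow.simps)
qed

lemma mat_action_minus:
  fixes A B :: "'a::ring_1 mat"
  assumes "A \<in> carrier_mat n n" "B \<in> carrier_mat n n"
  shows "mat_action (A - B) x = mat_action A x - mat_action B x"
  using assms by (auto simp: mat_action_def fun_eq_iff left_diff_distrib sum_subtractf)

lemma fun_sum_apply: "(\<Sum>k\<in>K. g k) i = (\<Sum>k\<in>K. g k i :: 'a::comm_monoid_add)"
  by (induction K rule: infinite_finite_induct) simp_all

lemma two_element_ring_expansion:
  fixes x :: "nat \<Rightarrow> 'a::ring_1"
  assumes U: "(UNIV :: 'a set) = {0, 1}" and x: "x \<in> coord_vectors n"
  shows "x = (\<Sum>k\<in>{k. k < n \<and> x k = 1}. coord_unit k)"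
proof
  fix i
  have "x i = 0 \<or> x i = 1" using U by auto
  moreover have "(\<Sum>k\<in>{k. k < n \<and> x k = 1}. coord_unit k) i
      = (\<Sum>k\<in>{k. k < n \<and> x k = 1}. if k = i then 1 else 0)"
    unfolding fun_sum_apply coord_unit_def by (rule sum.cong) auto
  moreover have "i < n" if "x i = 1"
  proof (rule ccontr)
    assume "\<not> i < n"
    then show False using x that by (simp add: coord_vectors_def)
  qed
  ultimately show "x i = (\<Sum>k\<in>{k. k < n \<and> x k = 1}. coord_unit k) i"
    by auto
qed

text \<open>
  The action of \<open>A\<close> splits by the linear theorem above; reading off the columns of the idempotent part
  gives \<open>E\<close>. That \<open>E\<close> acts as this part needs additivity only, since every vector is a sum of unit
  vectors.
\<close>

lemma two_element_mat_nil_clean: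
  fixes A :: "'a::ring_1 mat"
  assumes U: "(UNIV :: 'a set) = {0, 1}" and A: "A \<in> carrier_mat n n"
  shows "\<exists>E Z :: 'a mat. E \<in> carrier_mat n n \<and> Z \<in> carrier_mat n n \<and>
      E * E = E \<and> A = E + Z \<and> (\<exists>k. Z ^\<^sub>m k = 0\<^sub>m n n)"
proof -
  have el: "c = 0 \<or> c = 1" for c :: 'a using U by auto
  have two: "1 + 1 = (0 :: 'a)"
    using el[of "1 + 1"] add_left_cancel[of 1 1 "0 :: 'a"] by (auto simp del: one_add_one)
  have "c + c = 0" for c :: 'a using el[of c] two by auto
  then have "x + x = 0" for x :: "nat \<Rightarrow> 'a" by (simp add: fun_eq_iff)
  then interpret bit_vector_space "bit_scale :: bit \<Rightarrow> (nat \<Rightarrow> 'a) \<Rightarrow> (nat \<Rightarrow> 'a)"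
    by (rule bit_vector_space_bit_scale)
  let ?V = "coord_vectors n :: (nat \<Rightarrow> 'a) set"
  let ?f = "mat_action A"
  have V: "subspace ?V"
    by (rule subspaceI) (auto simp: coord_vectors_def bit_scale_def)
  have "finite (UNIV :: 'a set)" unfolding U by simp
  then have fin: "finite ?V"
    using finite_set_of_finite_funs[of "{..<n}" "UNIV :: 'a set" 0]
    by (auto simp: coord_vectors_def not_less elim: rev_finite_subset)
  have lf: "lin ?f" by (rule lin_if_additive) (rule mat_action_add)
  have fV: "?f ` ?V \<subseteq> ?V" using mat_action_coord_vectors[OF A] by blast
  obtain e where "nil_clean_on ?f ?V e"
    using finite_nil_clean[OF lf V fin fV] by (elim exE)
  then obtain k where le: "lin e" and eV: "\<And>x. x \<in> ?V \<Longrightarrow> e x \<in> ?V"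
    and idem: "\<And>x. x \<in> ?V \<Longrightarrow> e (e x) = e x"
    and nil: "\<And>x. x \<in> ?V \<Longrightarrow> ((\<lambda>x. ?f x - e x) ^^ k) x = 0"
    unfolding nil_clean_on_def by auto

  define E where "E = mat n n (\<lambda>(i, k). e (coord_unit k) i)"
  have E: "E \<in> carrier_mat n n" by (simp add: E_def)
  have act_unit: "mat_action E (coord_unit k) = e (coord_unit k)" if "k < n" for k
  proof
    fix i
    show "mat_action E (coord_unit k) i = e (coord_unit k) i"
    proof (cases "i < n")
      case True
      then show ?thesis using mat_action_unit[of i E k] E that by (simp add: E_def)
    next
      case False
      have "e (coord_unit k) \<in> ?V" using that by (intro eV coord_unit_coord_vectors)
      then show ?thesis using False E by (simp add: mat_action_def coord_vectors_def)
    qed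
  qed
  have act: "mat_action E x = e x" if "x \<in> ?V" for x
  proof -
    let ?K = "{k. k < n \<and> x k = 1}"
    note ex = two_element_ring_expansion[OF U that]
    have lE: "lin (mat_action E)" by (rule lin_if_additive) (rule mat_action_add)
    have "mat_action E (\<Sum>k\<in>?K. coord_unit k) = (\<Sum>k\<in>?K. mat_action E (coord_unit k))"
      by (rule linear_sum[OF lE])
    also have "\<dots> = (\<Sum>k\<in>?K. e (coord_unit k))"
      by (rule sum.cong) (auto simp: act_unit)
    also have "\<dots> = e (\<Sum>k\<in>?K. coord_unit k)"
      by (rule linear_sum[OF le, symmetric])
    finally show ?thesis unfolding ex[symmetric] .
  qed
  have EE: "E * E = E"
    using E by (intro mat_eqI_action[of _ n]) (simp_all add: mat_action_mult[of _ n] act eV idem)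
  define Z where "Z = A - E"
  have Z: "Z \<in> carrier_mat n n" unfolding Z_def by (rule minus_carrier_mat[OF E])
  define g where "g = (\<lambda>x. ?f x - e x)"
  have act_Z: "mat_action Z x = g x" if "x \<in> ?V" for x
    using act[OF that] by (simp only: Z_def mat_action_minus[OF A E] g_def)
  have "(mat_action Z ^^ i) x = (g ^^ i) x \<and> (mat_action Z ^^ i) x \<in> ?V" if "x \<in> ?V" for x i
  proof (induction i)
    case (Suc i)
    then have "mat_action Z ((mat_action Z ^^ i) x) = g ((g ^^ i) x)"
      using act_Z by metis
    then show ?case
      using mat_action_coord_vectors[OF Z, of "(mat_action Z ^^ i) x"] by simp
  qed (use that in simp)
  then have nilZ: "(mat_action Z ^^ k) x = 0" if "x \<in> ?V" for x
    using that nil unfolding g_def[symmetric] by metis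
  then have "Z ^\<^sub>m k = 0\<^sub>m n n"
  proof (intro mat_eqI_action[of _ n])
    fix x :: "nat \<Rightarrow> 'a" assume "x \<in> ?V"
    then have "mat_action (Z ^\<^sub>m k) x = 0"
      using mat_action_pow[OF Z] nilZ by metis
    moreover have "mat_action (0\<^sub>m n n) x = 0" by (rule ext) (simp add: mat_action_def)
    ultimately show "mat_action (Z ^\<^sub>m k) x = mat_action (0\<^sub>m n n) x" by simp
  qed (use Z in simp_all)
  moreover have "A = E + Z" using A E by (auto simp: Z_def)
  ultimately show ?thesis using E Z EE by blast
qed

section \<open>The characterization\<close>

text \<open>
  A ring with two elements has no choice in its operations: \<open>1 + 1\<close> cannot be \<open>1\<close>.
\<close>

lemma two_element_iff_iso_bit:
  "(class_ring :: 'a::division_ring ring) \<simeq> (class_ring :: bit ring) \<longleftrightarrow> (UNIV :: 'a set) = {0, 1}"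
proof
  assume "(class_ring :: 'a ring) \<simeq> (class_ring :: bit ring)"
  then obtain h :: "'a \<Rightarrow> bit" where "bij h"
    by (auto simp: is_ring_iso_def ring_iso_def)
  then have "inj h" by (rule bij_is_inj)
  show "(UNIV :: 'a set) = {0, 1}"
  proof (rule ccontr)
    assume "(UNIV :: 'a set) \<noteq> {0, 1}"
    then obtain x :: 'a where "x \<noteq> 0" "x \<noteq> 1" by auto
    with \<open>inj h\<close> have "h x \<noteq> h 0" "h x \<noteq> h 1" "h 0 \<noteq> h 1" by (auto simp: inj_eq)
    then show False by (cases "h x"; cases "h 0"; cases "h 1") auto
  qed
next
  assume U: "(UNIV :: 'a set) = {0, 1}"
  then have cases: "x = 0 \<or> x = 1" for x :: 'a by auto
  have two: "1 + 1 = (0 :: 'a)" using cases[of "1 + 1"] add_left_cancel[of 1 1 "0 :: 'a"]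
    by (auto simp del: one_add_one)
  define h where "h x = (if x = 0 then 0 else (1 :: bit))" for x :: 'a
  have h01: "h 0 = 0" "h 1 = 1" by (simp_all add: h_def)
  have mult: "h (x * y) = h x * h y" for x y
    using cases[of x] cases[of y] h01 by auto
  have add: "h (x + y) = h x + h y" for x y
    using cases[of x] cases[of y] h01 two by auto
  have "bij h"
  proof (rule bijI)
    show "inj h"
      unfolding inj_def using cases h01 by (metis zero_neq_one)
    have "y \<in> range h" for y
      by (cases y) (use range_eqI[of y h 0] range_eqI[of y h 1] h01 in simp_all)
    then show "surj h" by blast
  qed
  moreover have "h \<in> Ring.ring_hom (class_ring :: 'a ring) (class_ring :: bit ring)"
    by (rule ring_hom_memI) (simp_all add: mult add h01)
  ultimately have "h \<in> ring_iso (class_ring :: 'a ring) (class_ring :: bit ring)"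
    by (simp add: ring_iso_def)
  then show "(class_ring :: 'a ring) \<simeq> (class_ring :: bit ring)"
    by (auto simp: is_ring_iso_def)
qed

theorem theorem5p5:
  fixes n :: nat
  assumes "n \<ge> 1"
  shows "sqrtJ_clean_ring (ring_mat TYPE('a::division_ring) n ()) \<longleftrightarrow>
    (class_ring :: 'a ring) \<simeq> (class_ring :: bit ring)"
proof -
  have n: "0 < n" using assms by simp
  show ?thesis
    unfolding two_element_iff_iso_bit sqrtJ_clean_mat_iff[OF n]
  proof
    assume clean: "\<forall>A \<in> carrier_mat n n. \<exists>E Z :: 'a mat. E \<in> carrier_mat n n \<and>
      Z \<in> carrier_mat n n \<and> E * E = E \<and> A = E + Z \<and> (\<exists>k. Z ^\<^sub>m k = 0\<^sub>m n n)"
    have "a = 0 \<or> a = 1" for a :: 'a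
    proof -
      obtain E Z :: "'a mat" and k where "E \<in> carrier_mat n n" "E * E = E"
        "Z \<in> carrier_mat n n" "Z ^\<^sub>m k = 0\<^sub>m n n" "corner_mat n a = E + Z"
        using clean[rule_format, OF corner_mat_carrier[of n a]] by (elim exE conjE)
      from corner_nil_clean[OF this(1-4) n this(5)] show ?thesis .
    qed
    then show "(UNIV :: 'a set) = {0, 1}" by auto
  next
    assume U: "(UNIV :: 'a set) = {0, 1}"
    show "\<forall>A \<in> carrier_mat n n. \<exists>E Z :: 'a mat. E \<in> carrier_mat n n \<and>
      Z \<in> carrier_mat n n \<and> E * E = E \<and> A = E + Z \<and> (\<exists>k. Z ^\<^sub>m k = 0\<^sub>m n n)"
      by (intro ballI two_element_mat_nil_clean[OF U])
  qed
qed

end
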